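(* Consider the multi-objective integer programming (MOIP) problem of minimising $f_1(x),f_2(x),\dots,f_k(x)$ ($k\ge 2$) over $x\in X$, where $X$ is the set of points $x=(x_1,\dots,x_n)$ satisfying a system of linear equations $Ax=b$ with $x_j\ge 0$ and $x_j\in\mathbb{Z}$ for all $j\in\{1,\dots,n\}$, and where $f_i(x)=\sum_{j=1}^n c_{ij}x_j$ with $c_{ij}\in\mathbb{Z}$ for all $i\in\{1,\dots,k\}$ and $j\in\{1,\dots,n\}$. Then the improved recursive algorithm (described in the context) generates all $k$-objective nondominated objective vectors for this MOIP problem.
   Context: **Nondominated vectors.** A point $x'\in X$ is $k$-objective efficient if and only if there is no $x\in X$ such that $f_i(x)\le f_i(x')$ for each $i\in\{1,\dots,k\}$ and $f_i(x)<f_i(x')$ for at least one $i$. The resulting objective vector $(f_1(x'),\dots,f_k(x'))$ is then said to be $k$-objective nondominated. **Constrained lexicographic problems (CLMOIPs).** For $1\le q\le k-1$ and bounds $l_{q+1},\dots,l_k$ (each an integer or $\infty$), $(q,l_{q+1},\dots,l_k)$ denotes the problem: first lexicographic objective, minimise $f_1(x),\dots,f_q(x)$ (as a multi-objective problem); second lexicographic objective, minimise $f_{q+1}(x)$; subject to $f_{q+1}(x)\le l_{q+1},\dots,f_k(x)\le l_k$ and $x\in X$. **Relaxations.** The CLMOIP $(q,l'_{q+1},\dots,l'_k)$ is a relaxation of $(q,l_{q+1},\dots,l_k)$ if $l'_i\ge l_i$ for all $i=q+1,\dots,k$ and $l'_i>l_i$ for some $i=q+1,\dots,k$. **The improved recursive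 algorithm.** A list of the CLMOIPs already solved, at all levels of the recursion, is kept together with their sets of nondominated objective vectors (or the information that they are infeasible). For the $k$-objective problem: - Step 0. Set $l_k=\infty$ and $ND_k=\emptyset$. - Step 1. Go through the relaxations of the current CLMOIP $(k-1,l_k)$ found in the list of previously solved CLMOIPs. If such a relaxation is feasible and all of its nondominated objective vectors are feasible for the current CLMOIP, let that nondominated set be $ND^*_{k-1}$ and go to Step 3. If the relaxation is infeasible, stop. Repeat until there are no other relaxations of the current CLMOIP in the list. - Step 2. Solve the current CLMOIP $(k-1,l_k)$, using this same algorithm recursively to optimise the first $k-1$ objectives. If the problem is infeasible, stop. Otherwise let $ND^*_{k-1}$ be the resulting $(k-1)$-objective nondominated set. - Step 3. Replace $ND_k$ by $ND_k\cup ND^*_{k-1}$, set $l_k=\max\{f_k : f\in ND^*_{k-1}\}-1$, and go to Step 1. In the recursive calls, the constraints $f_i(x)\le l_i$ imposed at higher levels are kept, so that the intermediate problems are the CLMOIPs $(q,l_{q+1},\dots,l_k)$, and stopping means stopping the current call, which returns its set of collected vectors. The deepest problems, with $q=1$, are single-objective integer programs, solved directly; objective vectors are obtained by minimising the remaining lexicographic objectives up the recursion stack. The output of the algorithm is the set $ND_k$.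
   Formalization: The algorithm may have no output if an objective is unbounded below on X (e.g. X={x≥0}, f_1=−x, f_2=x); so it is shown that any output contains all nondominated vectors, and that an output is reached whenever every f_i is bounded below on X. *)

theory Defs
  imports "HOL-Analysis.Analysis" "HOL-Library.Extended" "HOL-Library.Monad_Syntax"
begin

definition feasible_set :: "real ^ 'n ^ 'm \<Rightarrow> real ^ 'm \<Rightarrow> (int ^ 'n) set" where
  "feasible_set A b = {x. A *v (\<chi> j. real_of_int (x $ j)) = b \<and> (\<forall>j. 0 \<le> x $ j)}"

definition objective :: "(nat \<Rightarrow> int ^ 'n) \<Rightarrow> nat \<Rightarrow> int ^ 'n \<Rightarrow> int" where
  "objective c i x = (\<Sum>j\<in>UNIV. c i $ j * x $ j)"

text \<open>Objectives are numbered from 1 to k. An objective vector is an extensional function on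
  \<open>{1..k}\<close>, so that two objective vectors are equal iff all k components agree.\<close>

type_synonym objvec = "nat \<Rightarrow> int"

definition objective_vector :: "(nat \<Rightarrow> 'x \<Rightarrow> int) \<Rightarrow> nat \<Rightarrow> 'x \<Rightarrow> objvec" where
  "objective_vector f k x = (\<lambda>i\<in>{1..k}. f i x)"

definition efficient :: "(nat \<Rightarrow> 'x \<Rightarrow> int) \<Rightarrow> nat \<Rightarrow> 'x set \<Rightarrow> 'x \<Rightarrow> bool" where
  "efficient f k X x' \<longleftrightarrow> x' \<in> X \<and>
     \<not> (\<exists>x\<in>X. (\<forall>i\<in>{1..k}. f i x \<le> f i x') \<and> (\<exists>i\<in>{1..k}. f i x < f i x'))"

definition nondominated_vectors :: "(nat \<Rightarrow> 'x \<Rightarrow> int) \<Rightarrow> nat \<Rightarrow> 'x set \<Rightarrow> objvec set" where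
  "nondominated_vectors f k X = objective_vector f k ` {x. efficient f k X x}"

text \<open>\<open>(q, l)\<close> stands for the constrained lexicographic problem \<open>(q, l (q+1), \<dots>, l k)\<close>;
  the values of \<open>l\<close> outside \<open>{q+1..k}\<close> are irrelevant.\<close>

type_synonym clmoip = "nat \<times> (nat \<Rightarrow> int extended)"

definition within_bounds :: "nat \<Rightarrow> clmoip \<Rightarrow> objvec \<Rightarrow> bool" where
  "within_bounds k P v \<longleftrightarrow> (case P of (q, l) \<Rightarrow> \<forall>i\<in>{q+1..k}. Fin (v i) \<le> l i)"

definition relaxation :: "nat \<Rightarrow> clmoip \<Rightarrow> clmoip \<Rightarrow> bool" where
  "relaxation k P' P \<longleftrightarrow> (case P' of (q', l') \<Rightarrow> case P of (q, l) \<Rightarrow>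
     q' = q \<and> (\<forall>i\<in>{q+1..k}. l i \<le> l' i) \<and> (\<exists>i\<in>{q+1..k}. l i < l' i))"

text \<open>The list of solved problems. The empty set records that a problem is infeasible
  (a problem that is feasible and has been solved has at least one nondominated vector).\<close>

type_synonym solved = "(clmoip \<times> objvec set) list"

primrec lex_minimisers :: "(nat \<Rightarrow> 'x \<Rightarrow> int) \<Rightarrow> nat list \<Rightarrow> 'x set \<Rightarrow> 'x set" where
  "lex_minimisers f [] Y = Y"
| "lex_minimisers f (i # is) Y = lex_minimisers f is {x\<in>Y. \<forall>y\<in>Y. f i x \<le> f i y}"

text \<open>The deepest problems \<open>(1, l)\<close>: minimise the first objective, then the remaining lexicographic
  objectives 2, ..., k, met in this order going up the recursion stack. The result is \<open>Some {}\<close> for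
  an infeasible problem, \<open>Some {v}\<close> if \<open>v\<close> is the optimal objective vector, and \<open>None\<close> if the problem
  is feasible but one of the minima is not attained (an unbounded integer program).\<close>

definition solve_single ::
  "(nat \<Rightarrow> 'x \<Rightarrow> int) \<Rightarrow> nat \<Rightarrow> 'x set \<Rightarrow> (nat \<Rightarrow> int extended) \<Rightarrow> objvec set option" where
  "solve_single f k X l =
     (let Y = {x\<in>X. within_bounds k (1, l) (objective_vector f k x)};
          M = lex_minimisers f [1..<k+1] Y
      in if Y = {} then Some {}
         else if M = {} then None
         else Some (objective_vector f k ` M))"

text \<open>Step 1, for a list of solved problems given in the order in which it is gone through.
  \<open>Some {}\<close>: an infeasible relaxation was found; \<open>Some N\<close> with nonempty \<open>N\<close>: the nondominated set
  of a relaxation can be reused; \<open>None\<close>: the relaxations in the list are exhausted.\<close>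

primrec search_relaxations :: "nat \<Rightarrow> clmoip \<Rightarrow> solved \<Rightarrow> objvec set option" where
  "search_relaxations k P [] = None"
| "search_relaxations k P (e # es) =
     (case e of (R, N) \<Rightarrow>
        if relaxation k R P \<and> (N = {} \<or> (\<forall>v\<in>N. within_bounds k P v)) then Some N
        else search_relaxations k P es)"

text \<open>Steps 1 to 3 of the algorithm for the first \<open>q + 1\<close> objectives, where \<open>l (q+1)\<close> is the moving
  bound, \<open>ND\<close> the set collected so far, and \<open>S\<close> the solver for the problems \<open>(q, l)\<close> used in Step 2.
  The order in which Step 1 goes through the solved problems \<open>L\<close> is given by \<open>arrange\<close>.
  The result \<open>None\<close> means that the loop runs forever or that a call of \<open>S\<close> gives no result.\<close>

partial_function (option) steps ::
  "(clmoip \<Rightarrow> solved \<Rightarrow> solved) \<Rightarrow> nat \<Rightarrow> nat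
   \<Rightarrow> ((nat \<Rightarrow> int extended) \<Rightarrow> solved \<Rightarrow> (objvec set \<times> solved) option)
   \<Rightarrow> (nat \<Rightarrow> int extended) \<Rightarrow> objvec set \<Rightarrow> solved \<Rightarrow> (objvec set \<times> solved) option" where
  "steps arrange k q S l ND L = do {
     (N, L') \<leftarrow> (case search_relaxations k (q, l) (arrange (q, l) L) of
         Some N \<Rightarrow> Some (N, L)
       | None \<Rightarrow> do { (N, L') \<leftarrow> S l L; Some (N, ((q, l), N) # L') });
     if N = {} then Some (ND, L')
     else steps arrange k q S
            (l(q + 1 := Fin (Max ((\<lambda>v. v (q + 1)) ` N) - 1))) (ND \<union> N) L'
   }"

text \<open>\<open>recursive_call arrange f k X p l L\<close> is the algorithm applied to the first \<open>p\<close> objectives under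
  the bounds \<open>l (p+1), \<dots>, l k\<close> kept from the higher levels. It returns the collected objective
  vectors and the extended list of solved problems.\<close>

fun recursive_call ::
  "(clmoip \<Rightarrow> solved \<Rightarrow> solved) \<Rightarrow> (nat \<Rightarrow> 'x \<Rightarrow> int) \<Rightarrow> nat \<Rightarrow> 'x set \<Rightarrow> nat
   \<Rightarrow> (nat \<Rightarrow> int extended) \<Rightarrow> solved \<Rightarrow> (objvec set \<times> solved) option" where
  "recursive_call arrange f k X 0 l L = None"
| "recursive_call arrange f k X (Suc 0) l L = map_option (\<lambda>N. (N, L)) (solve_single f k X l)"
| "recursive_call arrange f k X (Suc (Suc q)) l L =
     steps arrange k (Suc q) (recursive_call arrange f k X (Suc q)) (l(Suc (Suc q) := Pinf)) {} L"

definition improved_algorithm ::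
  "(clmoip \<Rightarrow> solved \<Rightarrow> solved) \<Rightarrow> (nat \<Rightarrow> 'x \<Rightarrow> int) \<Rightarrow> nat \<Rightarrow> 'x set \<Rightarrow> objvec set option" where
  "improved_algorithm arrange f k X =
     map_option fst (recursive_call arrange f k X k (\<lambda>_. Pinf) [])"

end

theory Submission
  imports Defs
begin

text \<open>Each set \<open>N\<close> that the algorithm records for a problem \<open>(q, l)\<close> is a finite set of objective
  vectors of feasible points such that every feasible point is weakly dominated, in the first \<open>q\<close>
  objectives, by a member of \<open>N\<close>. The lexicographic tie-breaking is not needed for this: if a point
  \<open>y\<close> satisfies the current bound on objective \<open>q + 1\<close> but not the next bound \<open>Max - 1\<close>, then every
  vector in \<open>N\<close> is at most as large as \<open>y\<close> in objective \<open>q + 1\<close>, so the one that dominates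
  \<open>y\<close> in the first \<open>q\<close> objectives also dominates it in the first \<open>q + 1\<close>. The property passes from a
  relaxation to the current problem when all its vectors satisfy the current bounds. At the top level
  the vector that weakly dominates an efficient point is its own objective vector.

  Termination holds because the moving bound strictly decreases, and below the infimum of the
  objective the current problem is infeasible.\<close>

section \<open>Dominating sets and their transfer between relaxations\<close>

definition clmoip_feasible :: "(nat \<Rightarrow> 'x \<Rightarrow> int) \<Rightarrow> nat \<Rightarrow> 'x set \<Rightarrow> clmoip \<Rightarrow> 'x set" where
  "clmoip_feasible f k X P = {x\<in>X. within_bounds k P (objective_vector f k x)}"

text \<open>Vectors that are themselves dominated may stay in \<open>N\<close>, so the property
  survives the unions of Step 3. The two inclusions make \<open>N\<close> empty exactly if the
  problem is infeasible, as in the solved list.\<close>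

definition dominating_set ::
  "(nat \<Rightarrow> 'x \<Rightarrow> int) \<Rightarrow> nat \<Rightarrow> 'x set \<Rightarrow> clmoip \<Rightarrow> objvec set \<Rightarrow> bool" where
  "dominating_set f k X P N \<longleftrightarrow> finite N \<and> N \<subseteq> objective_vector f k ` clmoip_feasible f k X P \<and>
     (\<forall>y\<in>clmoip_feasible f k X P. \<exists>v\<in>N. \<forall>i\<in>{1..fst P}. v i \<le> f i y)"

definition dominating_list :: "(nat \<Rightarrow> 'x \<Rightarrow> int) \<Rightarrow> nat \<Rightarrow> 'x set \<Rightarrow> solved \<Rightarrow> bool" where
  "dominating_list f k X L \<longleftrightarrow> (\<forall>(P, N)\<in>set L. dominating_set f k X P N)"

lemma clmoip_feasible_iff:
  "x \<in> clmoip_feasible f k X (q, l) \<longleftrightarrow> x \<in> X \<and> (\<forall>i\<in>{q+1..k}. Fin (f i x) \<le> l i)"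
  by (auto simp: clmoip_feasible_def within_bounds_def objective_vector_def)

lemma dominating_set_infeasible:
  assumes "dominating_set f k X P {}"
  shows "clmoip_feasible f k X P = {}"
  using assms by (auto simp: dominating_set_def)

lemma relaxation_feasible_subset:
  assumes "relaxation k R P"
  shows "clmoip_feasible f k X P \<subseteq> clmoip_feasible f k X R"
proof -
  obtain q l' l where "R = (q, l')" "P = (q, l)" "\<forall>i\<in>{q+1..k}. l i \<le> l' i"
    using assms by (cases R; cases P) (auto simp: relaxation_def)
  then show ?thesis
    by (simp add: subset_iff clmoip_feasible_iff) (meson order_trans)
qed

text \<open>The relaxation has more feasible points to cover, and the bound hypothesis makes its
  vectors admissible for \<open>P\<close>. For \<open>N = {}\<close> that hypothesis is vacuous, so
  an infeasible relaxation is included.\<close>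

lemma dominating_set_relaxation:
  assumes "dominating_set f k X R N" and "relaxation k R P" and "\<forall>v\<in>N. within_bounds k P v"
  shows "dominating_set f k X P N"
proof -
  have "fst R = fst P"
    using assms(2) by (auto simp: relaxation_def split: prod.splits)
  moreover have "N \<subseteq> objective_vector f k ` clmoip_feasible f k X P"
    using assms(1,3) unfolding dominating_set_def clmoip_feasible_def by blast
  ultimately show ?thesis
    using assms(1) relaxation_feasible_subset[OF assms(2)] unfolding dominating_set_def
    by (metis subsetD)
qed

lemma search_relaxations_dominating:
  assumes "search_relaxations k P L = Some N" and "dominating_list f k X L"
  shows "dominating_set f k X P N"
  using assms
proof (induction L)
  case (Cons e L)
  then show ?case
    by (cases e) (auto simp: dominating_list_def split: if_splits
        intro: dominating_set_relaxation)
qed simp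

section \<open>Lexicographic minimisation and the single-objective problems\<close>

lemma lex_minimisers_subset: "lex_minimisers f is Y \<subseteq> Y"
  by (induction "is" arbitrary: Y) auto

lemma lex_minimisers_equal:
  assumes "x \<in> lex_minimisers f is Y" "y \<in> lex_minimisers f is Y" "i \<in> set is"
  shows "f i x = f i y"
  using assms
proof (induction "is" arbitrary: Y)
  case (Cons j js)
  let ?Z = "{x\<in>Y. \<forall>y\<in>Y. f j x \<le> f j y}"
  have "x \<in> ?Z" "y \<in> ?Z"
    using Cons.prems lex_minimisers_subset[of f js ?Z] by auto
  then show ?case
    using Cons by (auto intro: antisym)
qed simp

text \<open>Shifting by a lower bound turns the values into naturals, which are
  well-ordered.\<close>

lemma bdd_below_int_attains_min:
  fixes g :: "'x \<Rightarrow> int"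
  assumes "bdd_below (g ` Y)" and "Y \<noteq> {}"
  shows "\<exists>x\<in>Y. \<forall>y\<in>Y. g x \<le> g y"
proof -
  obtain m where m: "\<And>y. y \<in> Y \<Longrightarrow> m \<le> g y"
    using assms(1) by (auto simp: bdd_below_def)
  obtain x where "x \<in> Y" "\<forall>y. y \<in> Y \<longrightarrow> nat (g x - m) \<le> nat (g y - m)"
    using assms(2) ex_has_least_nat[of "\<lambda>x. x \<in> Y" _ "\<lambda>x. nat (g x - m)"] by blast
  then show ?thesis
    using m by (intro bexI[of _ x]) force+
qed

lemma lex_minimisers_nonempty:
  assumes "\<And>i. i \<in> set is \<Longrightarrow> bdd_below (f i ` Y)" and "Y \<noteq> {}"
  shows "lex_minimisers f is Y \<noteq> {}"
  using assms
proof (induction "is" arbitrary: Y)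
  case (Cons j js)
  let ?Z = "{x\<in>Y. \<forall>y\<in>Y. f j x \<le> f j y}"
  have "?Z \<noteq> {}"
    using bdd_below_int_attains_min[of "f j" Y] Cons.prems by auto
  moreover have "bdd_below (f i ` ?Z)" if "i \<in> set js" for i
    by (rule bdd_below_mono[of "f i ` Y"]) (use Cons.prems that in auto)
  ultimately show ?case
    using Cons.IH[of ?Z] by simp
qed simp

lemma solve_single_dominating:
  assumes "solve_single f k X l = Some N" and "k \<ge> 1"
  shows "dominating_set f k X (1, l) N"
proof -
  let ?Y = "clmoip_feasible f k X (1, l)"
  let ?M = "lex_minimisers f [1..<k+1] ?Y"
  have N: "(?Y = {} \<and> N = {}) \<or> (?M \<noteq> {} \<and> N = objective_vector f k ` ?M)"
    using assms(1) by (auto simp: solve_single_def clmoip_feasible_def Let_def split: if_splits)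
  show ?thesis
  proof (cases "?Y = {}")
    case True
    then show ?thesis
      using N lex_minimisers_subset[of f "[1..<k+1]" ?Y] by (auto simp: dominating_set_def)
  next
    case False
    then obtain z where z: "z \<in> ?M" and NM: "N = objective_vector f k ` ?M"
      using N by blast
    \<comment> \<open>All lexicographic minimisers agree in every objective from 1 to
      \<open>k\<close>, so \<open>N\<close> is a singleton.\<close>
    have "objective_vector f k x = objective_vector f k z" if "x \<in> ?M" for x
      unfolding objective_vector_def
      by (rule restrict_ext, rule lex_minimisers_equal[OF that z]) auto
    then have Nz: "N = {objective_vector f k z}"
      unfolding NM using z by (intro equalityI subsetI) (blast, blast)
    \<comment> \<open>Splitting off the head shows that \<open>z\<close> minimises objective 1 over
      all of \<open>?Y\<close>, which is all that domination for \<open>(1, l)\<close> asks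
      for.\<close>
    have "[1..<k+1] = 1 # [2..<k+1]"
      using assms(2) upt_conv_Cons[of 1 "k + 1"] by (simp add: numeral_2_eq_2)
    then have "z \<in> {x\<in>?Y. \<forall>y\<in>?Y. f 1 x \<le> f 1 y}"
      using z lex_minimisers_subset[of f "[2..<k+1]"] by auto
    then show ?thesis
      using assms(2) by (auto simp: dominating_set_def Nz objective_vector_def)
  qed
qed

lemma solve_single_total:
  assumes "\<forall>i\<in>{1..k}. bdd_below (f i ` X)"
  shows "\<exists>N. solve_single f k X l = Some N"
proof -
  let ?Y = "clmoip_feasible f k X (1, l)"
  have "bdd_below (f i ` ?Y)" if "i \<in> set [1..<k+1]" for i
    by (rule bdd_below_mono[of "f i ` X"]) (use assms that in \<open>auto simp: clmoip_feasible_def\<close>)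
  then show ?thesis
    using lex_minimisers_nonempty[of "[1..<k+1]" f ?Y]
    by (auto simp: solve_single_def clmoip_feasible_def Let_def)
qed

section \<open>Partial correctness of Steps 1 and 2\<close>

definition solver_dominating ::
  "(nat \<Rightarrow> 'x \<Rightarrow> int) \<Rightarrow> nat \<Rightarrow> 'x set \<Rightarrow> nat
   \<Rightarrow> ((nat \<Rightarrow> int extended) \<Rightarrow> solved \<Rightarrow> (objvec set \<times> solved) option) \<Rightarrow> bool" where
  "solver_dominating f k X q S \<longleftrightarrow> (\<forall>l L N L'. dominating_list f k X L \<longrightarrow> S l L = Some (N, L') \<longrightarrow>
     dominating_set f k X (q, l) N \<and> dominating_list f k X L')"

text \<open>Steps 1 and 2 of a single pass, copied from the body of \<open>steps\<close> so that
  they can be folded there and treated on their own.\<close>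

definition lookup_or_solve ::
  "(clmoip \<Rightarrow> solved \<Rightarrow> solved) \<Rightarrow> nat \<Rightarrow> nat
   \<Rightarrow> ((nat \<Rightarrow> int extended) \<Rightarrow> solved \<Rightarrow> (objvec set \<times> solved) option)
   \<Rightarrow> (nat \<Rightarrow> int extended) \<Rightarrow> solved \<Rightarrow> (objvec set \<times> solved) option" where
  "lookup_or_solve arrange k q S l L =
     (case search_relaxations k (q, l) (arrange (q, l) L) of
        Some N \<Rightarrow> Some (N, L)
      | None \<Rightarrow> do { (N, L') \<leftarrow> S l L; Some (N, ((q, l), N) # L') })"

lemma lookup_or_solve_dominating:
  assumes "lookup_or_solve arrange k q S l L = Some (N, L')"
    and "\<And>P L. set (arrange P L) = set L"
    and "solver_dominating f k X q S" and "dominating_list f k X L"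
  shows "dominating_set f k X (q, l) N \<and> dominating_list f k X L'"
proof (cases "search_relaxations k (q, l) (arrange (q, l) L)")
  case None
  then obtain L'' where "S l L = Some (N, L'')" "L' = ((q, l), N) # L''"
    using assms(1) by (auto simp: lookup_or_solve_def split: bind_splits)
  then show ?thesis
    using assms(3,4) by (auto simp: solver_dominating_def dominating_list_def)
next
  case (Some M)
  have "dominating_list f k X (arrange (q, l) L)"
    using assms(2,4) by (simp add: dominating_list_def)
  then show ?thesis
    using assms(1,4) Some search_relaxations_dominating[OF Some]
    by (auto simp: lookup_or_solve_def)
qed

section \<open>Moving the bound and the loop invariant\<close>

lemma next_bound:
  assumes N: "dominating_set f k X (q, l) N" "N \<noteq> {}"
    and y: "y \<in> clmoip_feasible f k X (q, l)"
    and l': "l' = l(q + 1 := Fin (Max ((\<lambda>v. v (q + 1)) ` N) - 1))"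
  shows "y \<in> clmoip_feasible f k X (q, l') \<or> (\<exists>v\<in>N. \<forall>i\<in>{1..q+1}. v i \<le> f i y)"
proof (cases "f (q+1) y \<le> Max ((\<lambda>v. v (q + 1)) ` N) - 1")
  case True
  then show ?thesis
    using y by (auto simp: clmoip_feasible_iff l')
next
  case False
  obtain v where v: "v \<in> N" "\<forall>i\<in>{1..q}. v i \<le> f i y"
    using N(1) y unfolding dominating_set_def fst_conv by blast
  have "v (q+1) \<le> Max ((\<lambda>v. v (q + 1)) ` N)"
    using N(1) v(1) by (auto simp: dominating_set_def)
  \<comment> \<open>By integrality, violating the bound \<open>Max - 1\<close> means that
    \<open>f (q+1) y\<close> is at least the maximum.\<close>
  then have "\<forall>i\<in>{1..q+1}. v i \<le> f i y"
    using v(2) False by (auto simp: le_Suc_eq)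
  then show ?thesis
    using v(1) by blast
qed

text \<open>The maximum is attained by the vector of a feasible point, so it obeys the current
  bound, and the next bound is strictly smaller. It is also a value of the objective on
  \<open>X\<close>, so a lower bound of the objective applies to it. \<open>q < k\<close> ensures
  that component \<open>q + 1\<close> is a genuine one.\<close>

lemma next_bound_decreases:
  assumes "dominating_set f k X (q, l) N" "N \<noteq> {}" "q < k"
  shows "\<exists>x\<in>X. Max ((\<lambda>v. v (q + 1)) ` N) = f (q + 1) x \<and> Fin (f (q + 1) x) \<le> l (q + 1)"
proof -
  have "Max ((\<lambda>v. v (q + 1)) ` N) \<in> (\<lambda>v. v (q + 1)) ` N"
    using assms by (intro Max_in) (auto simp: dominating_set_def)
  then obtain v where "v \<in> N" "Max ((\<lambda>v. v (q + 1)) ` N) = v (q + 1)"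
    by auto
  moreover from this obtain x where "x \<in> clmoip_feasible f k X (q, l)" "v = objective_vector f k x"
    using assms(1) by (auto simp: dominating_set_def)
  ultimately show ?thesis
    using assms(3) by (auto simp: clmoip_feasible_iff objective_vector_def)
qed

text \<open>\<open>l0\<close> is the bound with which the loop was entered; \<open>ND\<close> has to dominate the points that the
  moving bound has already cut off.\<close>

definition loop_invariant ::
  "(nat \<Rightarrow> 'x \<Rightarrow> int) \<Rightarrow> nat \<Rightarrow> 'x set \<Rightarrow> nat \<Rightarrow> (nat \<Rightarrow> int extended)
   \<Rightarrow> (nat \<Rightarrow> int extended) \<Rightarrow> objvec set \<Rightarrow> bool" where
  "loop_invariant f k X q l0 l ND \<longleftrightarrow> (\<forall>i. i \<noteq> q + 1 \<longrightarrow> l i = l0 i) \<and> finite ND \<and>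
     ND \<subseteq> objective_vector f k ` clmoip_feasible f k X (q + 1, l0) \<and>
     (\<forall>y\<in>clmoip_feasible f k X (q + 1, l0).
        y \<in> clmoip_feasible f k X (q, l) \<or> (\<exists>v\<in>ND. \<forall>i\<in>{1..q+1}. v i \<le> f i y))"

lemma loop_invariant_step:
  assumes inv: "loop_invariant f k X q l0 l ND"
    and N: "dominating_set f k X (q, l) N" "N \<noteq> {}"
    and l': "l' = l(q + 1 := Fin (Max ((\<lambda>v. v (q + 1)) ` N) - 1))"
  shows "loop_invariant f k X q l0 l' (ND \<union> N)"
proof -
  \<comment> \<open>The current problem differs from the problem of the loop only by the constraint
    on objective \<open>q + 1\<close>.\<close>
  have "l0 i = l i" if "i \<noteq> q + 1" for i
    using inv that by (simp add: loop_invariant_def)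
  then have "clmoip_feasible f k X (q, l) \<subseteq> clmoip_feasible f k X (q + 1, l0)"
    by (auto simp: clmoip_feasible_iff)
  then have "N \<subseteq> objective_vector f k ` clmoip_feasible f k X (q + 1, l0)"
    using N(1) unfolding dominating_set_def by blast
  moreover have "y \<in> clmoip_feasible f k X (q, l') \<or>
      (\<exists>v\<in>ND \<union> N. \<forall>i\<in>{1..q+1}. v i \<le> f i y)"
    if "y \<in> clmoip_feasible f k X (q + 1, l0)" for y
  proof -
    from inv that consider "y \<in> clmoip_feasible f k X (q, l)"
      | "\<exists>v\<in>ND. \<forall>i\<in>{1..q+1}. v i \<le> f i y"
      unfolding loop_invariant_def by blast
    then show ?thesis
      using next_bound[OF N _ l', of y] by cases blast+
  qed
  moreover have "\<forall>i. i \<noteq> q + 1 \<longrightarrow> l' i = l0 i"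
    using inv by (simp add: loop_invariant_def l')
  moreover have "finite (ND \<union> N)"
    using inv N(1) by (simp add: loop_invariant_def dominating_set_def)
  ultimately show ?thesis
    using inv unfolding loop_invariant_def by simp
qed

text \<open>An empty answer leaves no point that the moving bound has not cut off, so
  \<open>ND\<close> covers everything.\<close>

lemma loop_invariant_exit:
  assumes "loop_invariant f k X q l0 l ND" and "dominating_set f k X (q, l) {}"
  shows "dominating_set f k X (q + 1, l0) ND"
  using assms(1) dominating_set_infeasible[OF assms(2)]
  by (auto simp: loop_invariant_def dominating_set_def)

lemma steps_dominating:
  assumes "steps arrange k q S l ND L = Some (N, L')"
    and arr: "\<And>P L. set (arrange P L) = set L"
    and S: "solver_dominating f k X q S" and "dominating_list f k X L"
    and "loop_invariant f k X q l0 l ND"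
  shows "dominating_set f k X (q + 1, l0) N \<and> dominating_list f k X L'"
proof -
  \<comment> \<open>Fixed-point induction varies all arguments of \<open>steps\<close> and has one
    variable for the result; hence the hypotheses become implications and the result is written as a
    pair with projections.\<close>
  have "(\<forall>P L. set (arrange P L) = set L) \<longrightarrow> solver_dominating f k X q S \<longrightarrow>
      dominating_list f k X L \<longrightarrow> loop_invariant f k X q l0 l ND \<longrightarrow>
      dominating_set f k X (q + 1, l0) (fst (N, L')) \<and> dominating_list f k X (snd (N, L'))"
  proof (rule steps.raw_induct[rotated, OF assms(1)], intro impI, goal_cases)
    case (1 steps arrange k q S l ND L r)
    obtain N L' where NL: "lookup_or_solve arrange k q S l L = Some (N, L')"
      and r: "(if N = {} then Some (ND, L') else steps arrange k q S
            (l(q + 1 := Fin (Max ((\<lambda>v. v (q + 1)) ` N) - 1))) (ND \<union> N) L') = Some r"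
      using 1(2) unfolding lookup_or_solve_def[symmetric] by (auto split: bind_splits)
    have good: "dominating_set f k X (q, l) N" "dominating_list f k X L'"
      using lookup_or_solve_dominating[OF NL _ 1(4,5)] 1(3) by auto
    show ?case
    proof (cases "N = {}")
      case True
      then show ?thesis
        using r good loop_invariant_exit[OF 1(6)] by auto
    next
      case False
      then show ?thesis
        using r 1(1)[of arrange k q S _ "ND \<union> N" L' r] 1(3,4) good
          loop_invariant_step[OF 1(6) good(1) False refl] by auto
    qed
  qed
  then show ?thesis
    using assms by simp
qed

text \<open>The bound \<open>Pinf\<close> excludes no point, so the empty collection
  suffices.\<close>

lemma loop_invariant_start: "loop_invariant f k X q l0 (l0(q + 1 := Pinf)) {}"
  by (auto simp: loop_invariant_def clmoip_feasible_iff)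

text \<open>Each level is the loop run with the level below as its solver. Level 0 never returns a
  result, so there the claim is vacuous.\<close>

lemma recursive_call_dominating:
  assumes "\<And>P L. set (arrange P L) = set L" and "k \<ge> 1"
  shows "solver_dominating f k X p (recursive_call arrange f k X p)"
proof (induction p)
  case 0
  then show ?case
    by (simp add: solver_dominating_def)
next
  case (Suc q)
  show ?case
  proof (cases q)
    case 0
    then show ?thesis
      using solve_single_dominating[OF _ assms(2)]
      by (auto simp: solver_dominating_def)
  next
    case (Suc q')
    show ?thesis
      unfolding solver_dominating_def
      using steps_dominating[OF _ assms(1) Suc.IH _ loop_invariant_start] Suc by auto
  qed
qed

section \<open>Termination for objectives bounded below\<close>

lemma steps_unfold:
  "steps arrange k q S l ND L = do {
     (N, L') \<leftarrow> lookup_or_solve arrange k q S l L;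
     if N = {} then Some (ND, L')
     else steps arrange k q S
            (l(q + 1 := Fin (Max ((\<lambda>v. v (q + 1)) ` N) - 1))) (ND \<union> N) L'
   }"
  by (subst steps.simps) (simp add: lookup_or_solve_def)

lemma lookup_or_solve_total:
  assumes "\<exists>r. S l L = Some r"
  shows "\<exists>r. lookup_or_solve arrange k q S l L = Some r"
  using assms by (auto simp: lookup_or_solve_def split: option.splits)

lemma steps_total_Fin:
  assumes arr: "\<And>P L. set (arrange P L) = set L"
    and S: "solver_dominating f k X q S"
    and total: "\<And>l L. dominating_list f k X L \<Longrightarrow> \<exists>r. S l L = Some r"
    and lower: "\<And>x. x \<in> X \<Longrightarrow> m \<le> f (q + 1) x" and "q < k"
    and "dominating_list f k X L" and "l (q + 1) = Fin B"
  shows "\<exists>r. steps arrange k q S l ND L = Some r"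
  using assms(6,7)
\<comment> \<open>In a pass that continues, the maximum lies between \<open>m\<close> and
  \<open>B\<close>, so the next bound lies between \<open>m - 1\<close> and \<open>B - 1\<close>.
  The summand 1 keeps the measure strictly decreasing in the last case, from \<open>m\<close> to
  \<open>m - 1\<close>.\<close>
proof (induction "nat (B - m + 1)" arbitrary: B l L ND rule: less_induct)
  case less
  obtain N L' where NL: "lookup_or_solve arrange k q S l L = Some (N, L')"
    using lookup_or_solve_total[of S l L arrange k q] total[OF less.prems(1)] by auto
  note good = lookup_or_solve_dominating[OF NL arr S less.prems(1)]
  show ?case
  proof (cases "N = {}")
    case True
    then show ?thesis
      by (subst steps_unfold) (simp add: NL)
  next
    case False
    let ?B = "Max ((\<lambda>v. v (q + 1)) ` N)"
    have "m \<le> ?B" "?B \<le> B"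
      using next_bound_decreases[OF conjunct1[OF good] False \<open>q < k\<close>] lower less.prems(2) by auto
    then have "\<exists>r. steps arrange k q S (l(q + 1 := Fin (?B - 1))) (ND \<union> N) L' = Some r"
      using good by (intro less.hyps[of "?B - 1"]) auto
    then show ?thesis
      using False by (subst steps_unfold) (simp add: NL)
  qed
qed

text \<open>The initial bound \<open>Pinf\<close> has no measure. One pass is unrolled, after which
  the loop has stopped or its bound is finite.\<close>

lemma steps_total:
  assumes arr: "\<And>P L. set (arrange P L) = set L"
    and S: "solver_dominating f k X q S"
    and total: "\<And>l L. dominating_list f k X L \<Longrightarrow> \<exists>r. S l L = Some r"
    and bdd: "bdd_below (f (q + 1) ` X)" and "q < k"
    and L: "dominating_list f k X L"
  shows "\<exists>r. steps arrange k q S l ND L = Some r"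
proof -
  obtain m where m: "\<And>x. x \<in> X \<Longrightarrow> m \<le> f (q + 1) x"
    using bdd by (auto simp: bdd_below_def)
  obtain N L' where NL: "lookup_or_solve arrange k q S l L = Some (N, L')"
    using lookup_or_solve_total[of S l L arrange k q] total[OF L] by auto
  have L': "dominating_list f k X L'"
    using lookup_or_solve_dominating[OF NL arr S L] by simp
  have "\<exists>r. steps arrange k q S (l(q + 1 := Fin B)) (ND \<union> N) L' = Some r" for B
    by (rule steps_total_Fin[OF arr S total m \<open>q < k\<close> L']) auto
  then show ?thesis
    by (subst steps_unfold) (simp add: NL)
qed

lemma recursive_call_total:
  assumes arr: "\<And>P L. set (arrange P L) = set L"
    and bdd: "\<forall>i\<in>{1..k}. bdd_below (f i ` X)"
    and "1 \<le> p" "p \<le> k" and "dominating_list f k X L"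
  shows "\<exists>r. recursive_call arrange f k X p l L = Some r"
  using assms(3-5)
proof (induction p arbitrary: l L rule: nat_induct_at_least)
  case base
  then show ?case
    using solve_single_total[OF bdd, of l] by auto
next
  case (Suc q)
  then obtain q' where q: "q = Suc q'"
    by (cases q) auto
  have "\<exists>r. steps arrange k q (recursive_call arrange f k X q) (l(Suc q := Pinf)) {} L = Some r"
    using Suc bdd by (intro steps_total[OF arr recursive_call_dominating[OF arr]]) auto
  then show ?case
    by (simp add: q)
qed

section \<open>From dominating sets to nondominated vectors\<close>

lemma dominating_set_contains_nondominated:
  assumes "dominating_set f k X (k, l) N"
  shows "nondominated_vectors f k X \<subseteq> N"
proof
  fix w
  assume "w \<in> nondominated_vectors f k X"
  then obtain y where y: "efficient f k X y" "w = objective_vector f k y"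
    by (auto simp: nondominated_vectors_def)
  \<comment> \<open>For \<open>q = k\<close> the range of bounded objectives is empty, so all of
    \<open>X\<close> is feasible.\<close>
  then have "y \<in> clmoip_feasible f k X (k, l)"
    by (simp add: efficient_def clmoip_feasible_iff)
  then obtain v where v: "v \<in> N" "\<forall>i\<in>{1..k}. v i \<le> f i y"
    using assms by (auto simp: dominating_set_def)
  obtain x where x: "x \<in> X" "v = objective_vector f k x"
    using assms v(1) by (auto simp: dominating_set_def clmoip_feasible_def)
  have "\<forall>i\<in>{1..k}. f i x \<le> f i y"
    using v(2) x(2) by (simp add: objective_vector_def)
  \<comment> \<open>A strict inequality anywhere would contradict the efficiency of
    \<open>y\<close>.\<close>
  then have "\<forall>i\<in>{1..k}. f i x = f i y"
    using y(1) x(1) unfolding efficient_def by (meson order_le_less)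
  then have "w = v"
    using x(2) y(2) by (auto simp: objective_vector_def restrict_def)
  then show "w \<in> N"
    using v(1) by simp
qed

theorem theorem9:
  fixes A :: "real ^ 'n ^ 'm" and b :: "real ^ 'm" and c :: "nat \<Rightarrow> int ^ 'n" and k :: nat
    and arrange :: "clmoip \<Rightarrow> solved \<Rightarrow> solved"
  assumes "k \<ge> 2"
    and "\<And>P L. set (arrange P L) = set L"
  shows "(\<forall>ND. improved_algorithm arrange (objective c) k (feasible_set A b) = Some ND \<longrightarrow>
             nondominated_vectors (objective c) k (feasible_set A b) \<subseteq> ND) \<and>
         ((\<forall>i\<in>{1..k}. bdd_below (objective c i ` feasible_set A b)) \<longrightarrow>
             (\<exists>ND. improved_algorithm arrange (objective c) k (feasible_set A b) = Some ND))"
proof (intro conjI allI impI)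
  let ?f = "objective c" and ?X = "feasible_set A b"
  have empty: "dominating_list ?f k ?X []"
    by (simp add: dominating_list_def)
  {
    fix ND
    assume "improved_algorithm arrange ?f k ?X = Some ND"
    then obtain L where "recursive_call arrange ?f k ?X k (\<lambda>_. Pinf) [] = Some (ND, L)"
      by (auto simp: improved_algorithm_def)
    then have "dominating_set ?f k ?X (k, \<lambda>_. Pinf) ND"
      using recursive_call_dominating[of arrange k ?f ?X k] assms empty
      by (auto simp: solver_dominating_def)
    then show "nondominated_vectors ?f k ?X \<subseteq> ND"
      by (rule dominating_set_contains_nondominated)
  }
  \<comment> \<open>Boundedness makes every single-objective minimum attained and keeps each moving
    bound from decreasing forever.\<close>
  assume "\<forall>i\<in>{1..k}. bdd_below (?f i ` ?X)"
  then show "\<exists>ND. improved_algorithm arrange ?f k ?X = Some ND"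
    using recursive_call_total[of arrange k ?f ?X k "[]" "\<lambda>_. Pinf"] assms empty
    by (auto simp: improved_algorithm_def)
qed

end
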